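(* Let $n\ge1$ and let $\boldsymbol{k}=(k_1,\dots,k_\ell)$ be integers with $0<k_1<\cdots<k_\ell\le n$. With respect to the positive structure on $\mathrm{Sp}_{2n}(\mathbf R)$ relative to $\Theta=\{\alpha_n\}$, the positive part $\mathsf{F}^{\mathrm{Sp}}_{\boldsymbol{k}}(\mathbf{R}^{2n})^{>0}$ consists precisely of those isotropic flags $(E_1, \dots, E_\ell)\in \mathsf{F}^{\mathrm{Sp}}_{\boldsymbol{k}}(\mathbf{R}^{2n})$ for which the subspace $E_\ell$ (and hence every $E_i$, $1\leq i\leq \ell$) is the graph of a positive definite symmetric map from a subspace of $L_0$ to $L_\infty$.
   Context: On $\mathbf R^{2n}$ with coordinates $(x_1,\dots,x_n,y_1,\dots,y_n)$ let $\omega=\sum_{i=1}^n dx_i\wedge dy_i$, and $\mathrm{Sp}_{2n}(\mathbf R)$ its isometry group. $L_0=\{y=0\}$ and $L_\infty=\{x=0\}$ are transverse Lagrangians, $\mathbf R^{2n}=L_0\oplus L_\infty$. A linear map $T\colon W\to L_\infty$ from a subspace $W\subset L_0$ is called symmetric if $\omega(v,T(w))=\omega(w,T(v))$ for all $v,w\in W$, and positive definite if moreover $\omega(v,T(v))>0$ for all $v\in W\smallsetminus\{0\}$; its graph is $\{v+T(v)\mid v\in W\}$. For the positive structure relative to $\Theta=\{\alpha_n\}$ (here $P_\Theta$, $P_\Theta^{\mathrm{opp}}$ are the stabilizers of $L_0$, $L_\infty$): $L_\Theta^\circ$ is the group of matrices $\begin{pmatrix}A&0\\0&(A^T)^{-1}\end{pmatrix}$,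 $A\in\mathrm{GL}_n(\mathbf R)$, $\det A>0$; $U_\Theta^{>0}$ is the set of matrices $\begin{pmatrix}\mathrm{Id}&M\\0&\mathrm{Id}\end{pmatrix}$ and $U_\Theta^{\mathrm{opp}>0}$ the set of matrices $\begin{pmatrix}\mathrm{Id}&0\\N&\mathrm{Id}\end{pmatrix}$ with $M,N$ symmetric positive definite; the non-negative semigroups $U_\Theta^{\geq 0}$, $U_\Theta^{\mathrm{opp}\ge0}$ are defined by positive semidefinite $M,N$. $G_\Theta^{\ge0}$ is the semigroup generated by $U_\Theta^{\ge0},L_\Theta^\circ,U_\Theta^{\mathrm{opp}\ge0}$, and $G_\Theta^{>0}$ is its interior in $\mathrm{Sp}_{2n}(\mathbf R)$; one has $G_\Theta^{>0}=U_\Theta^{\mathrm{opp}>0}L_\Theta^\circ U_\Theta^{>0}$. $\mathsf{F}^{\mathrm{Sp}}_{\boldsymbol{k}}(\mathbf{R}^{2n})$ is the space of flags $E_1\subset\cdots\subset E_\ell$ of isotropic subspaces of $\mathbf R^{2n}$ with $\dim E_i=k_i$. Its positive part is $\mathsf{F}^{\mathrm{Sp}}_{\boldsymbol{k}}(\mathbf{R}^{2n})^{>0}=\{g\cdot(F_1,\dots,F_\ell)\mid g\in G_\Theta^{>0},\ F_1\subset\cdots\subset F_\ell\subset L_0,\ \dim F_i=k_i\}$. *)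

theory Defs
  imports "HOL-Analysis.Analysis"
begin

text \<open>
  The space \<open>\<real>\<^sup>2\<^sup>n\<close> is \<^typ>\<open>real ^ ('n + 'n)\<close> with \<open>n = CARD('n)\<close>: the index \<open>Inl i\<close> carries the
  coordinate \<open>x\<^sub>i\<close> and \<open>Inr i\<close> carries \<open>y\<^sub>i\<close>.
\<close>

definition symp :: "real ^ ('n::finite + 'n) \<Rightarrow> real ^ ('n + 'n) \<Rightarrow> real" where
  "symp v w = (\<Sum>i\<in>UNIV. v $ Inl i * w $ Inr i - v $ Inr i * w $ Inl i)"

text \<open>As \<open>symp\<close> is nondegenerate, invertibility of its linear isometries is automatic.\<close>

definition Sp :: "(real ^ ('n::finite + 'n) ^ ('n + 'n)) set" where
  "Sp = {g. \<forall>v w. symp (g *v v) (g *v w) = symp v w}"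

definition L_zero :: "(real ^ ('n::finite + 'n)) set" where
  "L_zero = {v. \<forall>i. v $ Inr i = 0}"

definition L_infty :: "(real ^ ('n::finite + 'n)) set" where
  "L_infty = {v. \<forall>i. v $ Inl i = 0}"


definition linear_map_between ::
  "(real ^ ('n::finite + 'n)) set \<Rightarrow> (real ^ ('n + 'n)) set \<Rightarrow> (real ^ ('n + 'n) \<Rightarrow> real ^ ('n + 'n)) \<Rightarrow> bool" where
  "linear_map_between W V T \<longleftrightarrow>
     subspace W \<and> subspace V \<and> T \<in> W \<rightarrow> V \<and>
     (\<forall>v\<in>W. \<forall>w\<in>W. T (v + w) = T v + T w) \<and> (\<forall>c. \<forall>v\<in>W. T (c *\<^sub>R v) = c *\<^sub>R T v)"

definition symmetric_map ::
  "(real ^ ('n::finite + 'n)) set \<Rightarrow> (real ^ ('n + 'n) \<Rightarrow> real ^ ('n + 'n)) \<Rightarrow> bool" where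
  "symmetric_map W T \<longleftrightarrow>
     W \<subseteq> L_zero \<and> linear_map_between W L_infty T \<and>
     (\<forall>v\<in>W. \<forall>w\<in>W. symp v (T w) = symp w (T v))"

definition pos_def_map ::
  "(real ^ ('n::finite + 'n)) set \<Rightarrow> (real ^ ('n + 'n) \<Rightarrow> real ^ ('n + 'n)) \<Rightarrow> bool" where
  "pos_def_map W T \<longleftrightarrow> symmetric_map W T \<and> (\<forall>v\<in>W - {0}. symp v (T v) > 0)"

definition map_graph ::
  "(real ^ ('n::finite + 'n)) set \<Rightarrow> (real ^ ('n + 'n) \<Rightarrow> real ^ ('n + 'n)) \<Rightarrow> (real ^ ('n + 'n)) set" where
  "map_graph W T = {v + T v | v. v \<in> W}"

definition is_pos_def_graph :: "(real ^ ('n::finite + 'n)) set \<Rightarrow> bool" where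
  "is_pos_def_graph E \<longleftrightarrow> (\<exists>W T. pos_def_map W T \<and> E = map_graph W T)"


definition block_matrix ::
  "real ^ 'n::finite ^ 'n \<Rightarrow> real ^ 'n ^ 'n \<Rightarrow> real ^ 'n ^ 'n \<Rightarrow> real ^ 'n ^ 'n \<Rightarrow> real ^ ('n + 'n) ^ ('n + 'n)" where
  "block_matrix A B C D = (\<chi> r s. case r of
       Inl i \<Rightarrow> (case s of Inl j \<Rightarrow> A $ i $ j | Inr j \<Rightarrow> B $ i $ j)
     | Inr i \<Rightarrow> (case s of Inl j \<Rightarrow> C $ i $ j | Inr j \<Rightarrow> D $ i $ j))"

definition pos_semidef_matrix :: "real ^ 'n::finite ^ 'n \<Rightarrow> bool" where
  "pos_semidef_matrix M \<longleftrightarrow> transpose M = M \<and> (\<forall>x. x \<bullet> (M *v x) \<ge> 0)"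

definition L_Theta :: "(real ^ ('n::finite + 'n) ^ ('n + 'n)) set" where
  "L_Theta = {block_matrix A 0 0 (matrix_inv (transpose A)) | A. det A > 0}"

definition U_nonneg :: "(real ^ ('n::finite + 'n) ^ ('n + 'n)) set" where
  "U_nonneg = {block_matrix (mat 1) M 0 (mat 1) | M. pos_semidef_matrix M}"

definition U_opp_nonneg :: "(real ^ ('n::finite + 'n) ^ ('n + 'n)) set" where
  "U_opp_nonneg = {block_matrix (mat 1) 0 N (mat 1) | N. pos_semidef_matrix N}"

inductive_set semigroup_generated :: "(real ^ 'm ^ 'm) set \<Rightarrow> (real ^ 'm ^ 'm) set"
  for S :: "(real ^ 'm ^ 'm) set" where
  base: "g \<in> S \<Longrightarrow> g \<in> semigroup_generated S"
| mult: "g \<in> semigroup_generated S \<Longrightarrow> h \<in> semigroup_generated S \<Longrightarrow> g ** h \<in> semigroup_generated S"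

definition G_nonneg :: "(real ^ ('n::finite + 'n) ^ ('n + 'n)) set" where
  "G_nonneg = semigroup_generated (U_nonneg \<union> L_Theta \<union> U_opp_nonneg)"

definition G_pos :: "(real ^ ('n::finite + 'n) ^ ('n + 'n)) set" where
  "G_pos = top_of_set Sp interior_of G_nonneg"


definition flags :: "nat list \<Rightarrow> (real ^ ('n::finite + 'n)) set list set" where
  "flags k = {E. length E = length k \<and>
     (\<forall>i<length k. subspace (E ! i) \<and> dim (E ! i) = k ! i) \<and>
     (\<forall>i. Suc i < length k \<longrightarrow> E ! i \<subseteq> E ! Suc i)}"

definition isotropic :: "(real ^ ('n::finite + 'n)) set \<Rightarrow> bool" where
  "isotropic V \<longleftrightarrow> subspace V \<and> (\<forall>v\<in>V. \<forall>w\<in>V. symp v w = 0)"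

definition isotropic_flags :: "nat list \<Rightarrow> (real ^ ('n::finite + 'n)) set list set" where
  "isotropic_flags k = {E \<in> flags k. \<forall>V\<in>set E. isotropic V}"

definition positive_flags :: "nat list \<Rightarrow> (real ^ ('n::finite + 'n)) set list set" where
  "positive_flags k =
     {map (\<lambda>V. (\<lambda>v. g *v v) ` V) F | g F. g \<in> G_pos \<and> F \<in> flags k \<and> last F \<subseteq> L_zero}"

end

theory Submission
  imports Defs
begin

text \<open>
  The quadratic form \<open>q(x, y) = x \<bullet> y\<close> is not decreased by any of the generators of \<open>G_nonneg\<close>. An interior
  point \<open>g\<close> can be written as \<open>g = U\<^sup>o\<^sup>p\<^sup>p(d) U(d) g'\<close> with \<open>g'\<close> still in \<open>G_nonneg\<close> and \<open>d > 0\<close> small, so it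
  strictly increases \<open>q\<close>. As \<open>q\<close> vanishes on \<open>L_zero\<close>, images of subspaces of \<open>L_zero\<close> are isotropic
  with \<open>q > 0\<close>, which characterizes graphs of positive definite symmetric maps. Conversely, such a map
  extends to a positive definite \<open>N\<close> on all of \<open>L_zero\<close>, and \<open>U\<^sup>o\<^sup>p\<^sup>p(N) U(1)\<close>, an interior point of
  \<open>G_nonneg\<close>, maps \<open>L_zero\<close> onto the graph of \<open>N\<close>.
\<close>

section \<open>Coordinates, block matrices and the quadratic form\<close>

definition xp :: "real ^ ('n::finite + 'n) \<Rightarrow> real ^ 'n" where
  "xp v = (\<chi> i. v $ Inl i)"

definition yp :: "real ^ ('n::finite + 'n) \<Rightarrow> real ^ 'n" where
  "yp v = (\<chi> i. v $ Inr i)"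

definition join :: "real ^ 'n::finite \<Rightarrow> real ^ 'n \<Rightarrow> real ^ ('n + 'n)" where
  "join x y = (\<chi> r. case r of Inl i \<Rightarrow> x $ i | Inr i \<Rightarrow> y $ i)"

text \<open>This is the form \<open>q\<close> of the overview. At \<open>v + T v\<close> with
  \<open>v\<close> in \<open>L_zero\<close> and \<open>T v\<close> in \<open>L_infty\<close> it
  equals \<open>symp v (T v)\<close>, so positivity of a graph can be read off without naming
  \<open>T\<close>.\<close>

definition hyp :: "real ^ ('n::finite + 'n) \<Rightarrow> real" where
  "hyp v = xp v \<bullet> yp v"

lemma xp_join [simp]: "xp (join x y) = x" and yp_join [simp]: "yp (join x y) = y"
  by (simp_all add: xp_def yp_def join_def vec_eq_iff)

lemma vec_eq_xp_yp: "v = w \<longleftrightarrow> xp v = xp w \<and> yp v = yp w"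
  by (auto simp: xp_def yp_def vec_eq_iff split_sum_all)

lemma linear_xp [simp]: "linear xp" and linear_yp [simp]: "linear yp"
  by (auto intro!: linearI simp: xp_def yp_def vec_eq_iff)

lemmas xp_yp_linear [simp] =
  linear_0[OF linear_xp] linear_add[OF linear_xp] linear_diff[OF linear_xp] linear_cmul[OF linear_xp]
  linear_0[OF linear_yp] linear_add[OF linear_yp] linear_diff[OF linear_yp] linear_cmul[OF linear_yp]

lemma symp_eq: "symp v w = xp v \<bullet> yp w - yp v \<bullet> xp w"
  by (simp add: symp_def xp_def yp_def inner_vec_def sum_subtractf)

lemma L_zero_iff: "v \<in> L_zero \<longleftrightarrow> yp v = 0"
  by (simp add: L_zero_def yp_def vec_eq_iff)

lemma L_infty_iff: "v \<in> L_infty \<longleftrightarrow> xp v = 0"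
  by (simp add: L_infty_def xp_def vec_eq_iff)

lemma inner_eq_xp_yp: "v \<bullet> w = xp v \<bullet> xp w + yp v \<bullet> yp w"
  by (simp add: inner_vec_def xp_def yp_def UNIV_Plus_UNIV[symmetric] sum.Plus del: UNIV_Plus_UNIV)

lemma block_matrix_xp [simp]: "xp (block_matrix A B C D *v v) = A *v xp v + B *v yp v"
  and block_matrix_yp [simp]: "yp (block_matrix A B C D *v v) = C *v xp v + D *v yp v"
  by (simp_all add: block_matrix_def xp_def yp_def vec_eq_iff matrix_vector_mult_def
      UNIV_Plus_UNIV[symmetric] sum.Plus del: UNIV_Plus_UNIV)

lemma matrix_eq_xp_yp:
  "g = h \<longleftrightarrow> (\<forall>v. xp (g *v v) = xp (h *v v) \<and> yp (g *v v) = yp (h *v v))"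
  by (simp add: matrix_eq vec_eq_xp_yp)

lemma block_matrix_cases:
  obtains A B C D where "h = block_matrix A B C D"
proof
  show "h = block_matrix (\<chi> i j. h $ Inl i $ Inl j) (\<chi> i j. h $ Inl i $ Inr j)
    (\<chi> i j. h $ Inr i $ Inl j) (\<chi> i j. h $ Inr i $ Inr j)"
    by (simp add: vec_eq_iff block_matrix_def split_sum_all)
qed

lemma inner_vector_matrix:
  fixes A :: "real^'n^'m"
  shows "x \<bullet> (y v* A) = (A *v x) \<bullet> y"
  by (metis dot_lmul_matrix inner_commute)

lemma transpose_eqI:
  fixes M :: "real^'n^'n"
  assumes "\<And>x y. x \<bullet> (M *v y) = (M *v x) \<bullet> y"
  shows "transpose M = M"
proof -
  have "x \<bullet> (transpose M *v y) = x \<bullet> (M *v y)" for x y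
    by (simp add: inner_vector_matrix assms)
  then show ?thesis by (metis matrix_eq vector_eq_ldot)
qed

lemma matrix_inv_right_inverse:
  fixes A :: "real^'n^'n"
  assumes "invertible A"
  shows "A ** matrix_inv A = mat 1"
  using someI_ex[OF assms[unfolded invertible_def]] by (simp add: matrix_inv_def)

section \<open>Monotonicity of the form under the non-negative semigroup\<close>

text \<open>An upper unipotent adds the value of \<open>M\<close> at \<open>yp v\<close>, a lower
  one the value of \<open>N\<close> at \<open>xp v\<close>. A Levi element preserves the form
  because \<open>A\<close> and its inverse transpose cancel in the inner product.\<close>

lemma hyp_generator_le:
  assumes "g \<in> U_nonneg \<union> L_Theta \<union> U_opp_nonneg"
  shows "hyp v \<le> hyp (g *v v)"
  using assms
proof (elim UnE)
  assume "g \<in> U_nonneg"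
  then show ?thesis
    by (auto simp: U_nonneg_def hyp_def inner_add_left pos_semidef_matrix_def inner_commute[of "M *v w" w for M w])
next
  assume "g \<in> U_opp_nonneg"
  then show ?thesis
    by (auto simp: U_opp_nonneg_def hyp_def inner_add_right pos_semidef_matrix_def)
next
  assume "g \<in> L_Theta"
  then obtain A where A: "det A > 0" "g = block_matrix A 0 0 (matrix_inv (transpose A))"
    by (auto simp: L_Theta_def)
  then have "invertible (transpose A)"
    by (simp add: invertible_det_nz)
  then have inv: "transpose A ** matrix_inv (transpose A) = mat 1"
    by (rule matrix_inv_right_inverse)
  have "hyp (g *v v) = (transpose A *v (matrix_inv (transpose A) *v yp v)) \<bullet> xp v"
    by (simp add: hyp_def A dot_lmul_matrix) (rule inner_commute)
  also have "\<dots> = hyp v"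
    by (simp only: matrix_vector_mul_assoc inv) (simp add: hyp_def inner_commute)
  finally show ?thesis by simp
qed

lemma hyp_le_G_nonneg: "g \<in> G_nonneg \<Longrightarrow> hyp v \<le> hyp (g *v v)"
  unfolding G_nonneg_def
proof (induction arbitrary: v rule: semigroup_generated.induct)
  case (base g)
  then show ?case by (rule hyp_generator_le)
next
  case (mult g h)
  then show ?case
    using order_trans[OF mult.IH(2)[of v] mult.IH(1)[of "h *v v"]]
    by (simp add: matrix_vector_mul_assoc)
qed

section \<open>Strict monotonicity under the positive semigroup\<close>

lemma Sp_mult: "g \<in> Sp \<Longrightarrow> h \<in> Sp \<Longrightarrow> g ** h \<in> Sp"
  by (simp add: Sp_def matrix_vector_mul_assoc[symmetric])

lemma inj_Sp:
  assumes "g \<in> Sp"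
  shows "inj ((*v) g)"
proof (subst linear_injective_0[OF matrix_vector_mul_linear], intro allI impI)
  fix v assume "g *v v = 0"
  moreover have "symp (g *v v) (g *v u) = symp v u" for u
    using assms by (simp add: Sp_def)
  ultimately have "symp v u = 0" for u
    by (simp add: symp_eq)
  \<comment> \<open>The vector \<open>v\<close> rotated by a quarter turn: its pairing with
    \<open>v\<close> is the sum of the squared norms of \<open>xp v\<close> and
    \<open>yp v\<close>.\<close>
  from this[of "join (- yp v) (xp v)"] show "v = 0"
    by (auto simp: symp_eq vec_eq_xp_yp add_nonneg_eq_0_iff)
qed

text \<open>Covers symmetric matrices of any sign, since negative multiples of the identity occur in
  \<open>hyp_less_G_pos\<close>.\<close>

lemma unipotent_in_Sp:
  assumes "transpose M = M"
  shows "block_matrix (mat 1) M 0 (mat 1) \<in> Sp" "block_matrix (mat 1) 0 M (mat 1) \<in> Sp"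
proof -
  have "v v* M = M *v v" for v
    using assms transpose_matrix_vector[of M] by simp
  then have "(M *v x) \<bullet> y = x \<bullet> (M *v y)" for x y
    using dot_lmul_matrix[of x M y] by simp
  then show "block_matrix (mat 1) M 0 (mat 1) \<in> Sp" "block_matrix (mat 1) 0 M (mat 1) \<in> Sp"
    by (simp_all add: Sp_def symp_eq inner_add_left inner_add_right)
qed

lemma scalar_mat_vector_mult: "(c *\<^sub>R mat 1 :: real^'n^'n) *v x = c *\<^sub>R x"
  by (simp add: scaleR_matrix_vector_assoc[symmetric])

lemma continuous_on_matrix_mult:
  fixes f :: "'a::topological_space \<Rightarrow> real^'n^'m" and g :: "'a \<Rightarrow> real^'k^'n"
  assumes "continuous_on S f" "continuous_on S g"
  shows "continuous_on S (\<lambda>x. f x ** g x)"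
  unfolding matrix_matrix_mult_def by (intro continuous_intros assms)

lemma continuous_on_block_matrix:
  fixes A B C D :: "'a::topological_space \<Rightarrow> real^'n::finite^'n"
  assumes "continuous_on S A" "continuous_on S B" "continuous_on S C" "continuous_on S D"
  shows "continuous_on S (\<lambda>x. block_matrix (A x) (B x) (C x) (D x))"
proof -
  have "continuous_on S (\<lambda>x. block_matrix (A x) (B x) (C x) (D x) $ r $ s)" for r s
    using assms by (cases r; cases s) (auto simp: block_matrix_def intro!: continuous_intros)
  then have "continuous_on S (\<lambda>x. \<chi> r s. block_matrix (A x) (B x) (C x) (D x) $ r $ s)"
    by (intro continuous_on_vec_lambda)
  then show ?thesis by simp
qed

lemma matrix_vector_mult_minus: "(- A) *v x = - (A *v x)" for A :: "real^'n^'m"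
  by (simp add: matrix_vector_mult_def vec_eq_iff sum_negf)

lemma hyp_less_G_pos:
  fixes g :: "real ^ ('n::finite + 'n) ^ ('n + 'n)"
  assumes g: "g \<in> G_pos" and v: "v \<noteq> 0"
  shows "hyp v < hyp (g *v v)"
proof -
  \<comment> \<open>One-parameter subgroups: \<open>U (- d)\<close> and \<open>V (- d)\<close>
    invert \<open>U d\<close> and \<open>V d\<close>.\<close>
  define U where "U e = block_matrix (mat 1) (e *\<^sub>R mat 1) 0 (mat 1 :: real^'n^'n)" for e
  define V where "V e = block_matrix (mat 1) 0 (e *\<^sub>R mat 1) (mat 1 :: real^'n^'n)" for e
  obtain T where T: "open T" "g \<in> T" "g \<in> Sp" "T \<inter> Sp \<subseteq> G_nonneg"
    using g unfolding G_pos_def interior_of_def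
    by (auto simp: openin_subtopology)
  have inSp: "U e ** (V e ** g) \<in> Sp" for e
    using T(3) unfolding U_def V_def by (intro Sp_mult unipotent_in_Sp) (auto simp: transpose_scalar)
  have "continuous_on UNIV (\<lambda>e. U e ** (V e ** g))"
    unfolding U_def V_def
    by (intro continuous_on_matrix_mult continuous_on_block_matrix continuous_intros)
  then have "open ((\<lambda>e. U e ** (V e ** g)) -` T)"
    using T(1) by (simp add: open_vimage)
  moreover have "U 0 ** (V 0 ** g) = g"
    unfolding matrix_eq_xp_yp by (simp add: matrix_vector_mul_assoc[symmetric] U_def V_def)
  then have "0 \<in> (\<lambda>e. U e ** (V e ** g)) -` T"
    using T(2) by simp
  ultimately obtain d where d: "d > 0" "cball 0 d \<subseteq> (\<lambda>e. U e ** (V e ** g)) -` T"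
    by (meson open_contains_cball)
  \<comment> \<open>The ball is two-sided, so the parameter may be negative: \<open>g\<close> with
    the factors \<open>V d\<close> and \<open>U d\<close> stripped off on the left is still in
    \<open>G_nonneg\<close>.\<close>
  have "- d \<in> cball 0 d"
    using d(1) by (simp add: dist_real_def)
  then have "U (- d) ** (V (- d) ** g) \<in> T"
    using d(2) by blast
  then have "U (- d) ** (V (- d) ** g) \<in> G_nonneg"
    using T(4) inSp by blast
  define w where "w = (U (- d) ** (V (- d) ** g)) *v v"
  have le: "hyp v \<le> hyp w"
    unfolding w_def by (rule hyp_le_G_nonneg) fact
  have gv: "g *v v = V d *v (U d *v w)"
    unfolding vec_eq_xp_yp
    by (simp add: w_def U_def V_def matrix_vector_mul_assoc[symmetric] scalar_mat_vector_mult
        matrix_vector_mult_minus algebra_simps)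
  have "w \<noteq> 0"
  proof
    assume "w = 0"
    with gv have "g *v v = 0" by simp
    then have "v = 0"
      using linear_injective_0[OF matrix_vector_mul_linear, of g] inj_Sp[OF T(3)] by blast
    with v show False by simp
  qed
  then have "xp w + d *\<^sub>R yp w \<noteq> 0 \<or> yp w \<noteq> 0"
    by (auto simp: vec_eq_xp_yp)
  \<comment> \<open>The gain in the form: \<open>V d\<close> contributes the first summand and
    \<open>U d\<close> the second.\<close>
  then have "0 < d * ((xp w + d *\<^sub>R yp w) \<bullet> (xp w + d *\<^sub>R yp w)) + d * (yp w \<bullet> yp w)"
    using d(1) by (auto intro: add_pos_nonneg add_nonneg_pos)
  also have "\<dots> = hyp (g *v v) - hyp w"
    by (simp add: gv hyp_def U_def V_def scalar_mat_vector_mult inner_add_left inner_add_right algebra_simps)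
  finally show ?thesis using le by simp
qed

section \<open>Positive definite graphs and their extension to \<open>L_zero\<close>\<close>

text \<open>An intrinsic description that passes to subspaces and can be checked on images under
  \<open>Sp\<close>. Isotropy amounts to symmetry of the map; positivity of the form makes the
  projection to \<open>L_zero\<close> injective, so that there is a map at all.\<close>

lemma is_pos_def_graph_iff:
  "is_pos_def_graph E \<longleftrightarrow> isotropic E \<and> (\<forall>v\<in>E - {0}. hyp v > 0)"
proof (intro iffI conjI ballI)
  assume "is_pos_def_graph E"
  then obtain W T where WT: "pos_def_map W T" and E: "E = map_graph W T"
    by (auto simp: is_pos_def_graph_def)
  have W: "subspace W" "W \<subseteq> L_zero" and TW: "\<And>v. v \<in> W \<Longrightarrow> T v \<in> L_infty"
    and add: "\<And>v w. v \<in> W \<Longrightarrow> w \<in> W \<Longrightarrow> T (v + w) = T v + T w"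
    and scale: "\<And>c v. v \<in> W \<Longrightarrow> T (c *\<^sub>R v) = c *\<^sub>R T v"
    and sym: "\<And>v w. v \<in> W \<Longrightarrow> w \<in> W \<Longrightarrow> symp v (T w) = symp w (T v)"
    and pos: "\<And>v. v \<in> W \<Longrightarrow> v \<noteq> 0 \<Longrightarrow> symp v (T v) > 0"
    using WT by (auto simp: pos_def_map_def symmetric_map_def linear_map_between_def)
  have y0: "yp v = 0" if "v \<in> W" for v using that W by (auto simp: L_zero_iff)
  have x0: "xp (T v) = 0" if "v \<in> W" for v using that TW by (auto simp: L_infty_iff)
  have T0: "T 0 = 0" using scale[of 0 0] subspace_0[OF W(1)] by simp
  have "subspace E"
    unfolding E map_graph_def
  proof (rule subspaceI; (elim CollectE exE conjE, simp only:)?; rule CollectI)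
    show "\<exists>v. 0 = v + T v \<and> v \<in> W" using T0 subspace_0[OF W(1)] by (intro exI[of _ 0]) auto
    show "\<exists>u. v + T v + (w + T w) = u + T u \<and> u \<in> W" if "v \<in> W" "w \<in> W" for v w
      using that W(1) by (intro exI[of _ "v + w"]) (auto simp: add subspace_add)
    show "\<exists>u. c *\<^sub>R (v + T v) = u + T u \<and> u \<in> W" if "v \<in> W" for v c
      using that W(1) by (intro exI[of _ "c *\<^sub>R v"]) (auto simp: scale subspace_scale scaleR_add_right)
  qed
  then show "isotropic E"
    using sym by (auto simp: isotropic_def E map_graph_def symp_eq x0 y0 inner_commute)
  fix v assume "v \<in> E - {0}"
  then obtain w where "w \<in> W" "v = w + T w" "v \<noteq> 0"
    by (auto simp: E map_graph_def)
  with pos[of w] T0 show "hyp v > 0"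
    by (cases "w = 0") (auto simp: hyp_def symp_eq x0 y0)
next
  assume E: "isotropic E \<and> (\<forall>v\<in>E - {0}. hyp v > 0)"
  then have sub: "subspace E" and iso: "\<And>v w. v \<in> E \<Longrightarrow> w \<in> E \<Longrightarrow> symp v w = 0"
    by (auto simp: isotropic_def)
  \<comment> \<open>Projection to \<open>L_zero\<close> along \<open>L_infty\<close>. The form
    vanishes on its kernel, hence it is injective on \<open>E\<close>.\<close>
  define px where "px v = join (xp v) 0" for v :: "real ^ ('a + 'a)"
  have lpx: "linear px"
    by (intro linearI) (auto simp: px_def vec_eq_xp_yp)
  have "inj_on px E"
  proof (subst linear_injective_on_subspace_0[OF lpx sub], clarify)
    fix v assume "v \<in> E" "px v = 0"
    then have "hyp v = 0" by (auto simp: px_def vec_eq_xp_yp hyp_def)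
    with E \<open>v \<in> E\<close> show "v = 0" by (metis DiffI less_irrefl singletonD)
  qed
  then obtain g where g: "linear g" "\<And>v. v \<in> E \<Longrightarrow> g (px v) = v"
    using linear_exists_left_inverse_on[OF lpx sub] by auto
  define T where "T = (\<lambda>w. join 0 (yp (g w)))"
  have T: "T (px v) = join 0 (yp v)" if "v \<in> E" for v
    using that by (simp add: T_def g)
  have lT: "T (v + w) = T v + T w" "T (c *\<^sub>R v) = c *\<^sub>R T v" for v w c
    by (auto simp: T_def vec_eq_xp_yp linear_add[OF g(1)] linear_cmul[OF g(1)])
  have "subspace (L_infty :: (real ^ ('a + 'a)) set)"
    by (auto intro!: subspaceI simp: L_infty_iff)
  then have "linear_map_between (px ` E) L_infty T"
    using linear_subspace_image[OF lpx sub]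
    by (auto simp: linear_map_between_def lT) (simp add: T_def L_infty_iff)
  then have "symmetric_map (px ` E) T"
    using iso by (auto simp: symmetric_map_def T symp_eq L_zero_iff) (auto simp: px_def symp_eq inner_commute)
  then have "pos_def_map (px ` E) T"
    using E by (auto simp: pos_def_map_def T symp_eq hyp_def) (auto simp: px_def vec_eq_xp_yp)
  moreover have "E = map_graph (px ` E) T"
  proof -
    have "px v + T (px v) = v" if "v \<in> E" for v
      using that by (auto simp: T vec_eq_xp_yp) (auto simp: px_def)
    then show ?thesis by (force simp: map_graph_def)
  qed
  ultimately show "is_pos_def_graph E"
    by (auto simp: is_pos_def_graph_def)
qed

text \<open>Symmetry forces the pairing of the image of \<open>E\<close> under \<open>xp\<close>
  with every vector. The form is free on a complement of that image, where a multiple of the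
  standard form, large enough by a compactness bound on \<open>E\<close>, dominates the cross
  terms.\<close>

lemma pos_def_extension:
  fixes E :: "(real ^ ('n::finite + 'n)) set"
  assumes iso: "isotropic E" and pos: "\<And>v. v \<in> E \<Longrightarrow> v \<noteq> 0 \<Longrightarrow> hyp v > 0"
  obtains N :: "real^'n^'n" where "transpose N = N" "\<And>x. x \<noteq> 0 \<Longrightarrow> x \<bullet> (N *v x) > 0"
    "\<And>v. v \<in> E \<Longrightarrow> yp v = N *v xp v"
proof -
  have sub: "subspace E" using iso by (simp add: isotropic_def)
  have symm: "xp v \<bullet> yp w = yp v \<bullet> xp w" if "v \<in> E" "w \<in> E" for v w
    using iso that by (auto simp: isotropic_def symp_eq)
  have "inj_on xp E"
  proof (subst linear_injective_on_subspace_0[OF linear_xp sub], intro ballI impI)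
    fix v assume "v \<in> E" "xp v = 0"
    with pos[of v] show "v = 0" by (auto simp: hyp_def)
  qed
  \<comment> \<open>The values of \<open>g\<close> lie in \<open>E\<close> at every point, which
    makes \<open>xp \<circ> g\<close> a projection.\<close>
  then obtain g where g: "linear g" "\<And>x. g x \<in> E" "\<And>v. v \<in> E \<Longrightarrow> g (xp v) = v"
    using linear_exists_left_inverse_on[OF linear_xp sub] by (metis rangeI subsetD)
  \<comment> \<open>The minimum of the form on the unit sphere of \<open>E\<close>, extended by
    homogeneity. For \<open>E\<close> zero the sphere is empty and the constant 1 serves.\<close>
  obtain m where m: "m > 0" "\<And>v. v \<in> E \<Longrightarrow> hyp v \<ge> m * (norm v)\<^sup>2"
  proof (cases "E \<inter> sphere 0 1 = {}")
    case True
    have zero: "v = 0" if "v \<in> E" for v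
    proof (rule ccontr)
      assume "v \<noteq> 0"
      then have "(1 / norm v) *\<^sub>R v \<in> E \<inter> sphere 0 1"
        using that subspace_scale[OF sub] by auto
      with True show False by blast
    qed
    then have "hyp v \<ge> 1 * (norm v)\<^sup>2" if "v \<in> E" for v
      using zero[OF that] by (simp add: hyp_def)
    then show ?thesis by (rule that[of 1, OF zero_less_one])
  next
    case False
    have "compact (E \<inter> sphere 0 1)"
      by (intro closed_Int_compact closed_subspace[OF sub] compact_sphere)
    moreover have "continuous_on (E \<inter> sphere 0 1) hyp"
      unfolding hyp_def[abs_def]
      by (intro continuous_on_inner linear_continuous_on linear_conv_bounded_linear[THEN iffD1] linear_xp linear_yp)
    ultimately obtain u where u: "u \<in> E \<inter> sphere 0 1" "\<And>v. v \<in> E \<inter> sphere 0 1 \<Longrightarrow> hyp u \<le> hyp v"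
      using continuous_attains_inf[OF _ False] by blast
    have "hyp v \<ge> hyp u * (norm v)\<^sup>2" if "v \<in> E" for v
    proof (cases "v = 0")
      case False
      have "hyp u \<le> hyp ((1 / norm v) *\<^sub>R v)"
        by (rule u(2)) (use False that subspace_scale[OF sub] in auto)
      also have "\<dots> = hyp v / (norm v)\<^sup>2"
        by (simp add: hyp_def power2_eq_square)
      finally show ?thesis using False by (simp add: field_simps)
    qed (simp add: hyp_def)
    moreover have "hyp u > 0"
      using u(1) by (intro pos) auto
    ultimately show ?thesis using that by blast
  qed
  define P where "P = matrix (xp \<circ> g)"
  define S where "S = matrix (yp \<circ> g)"
  have P: "P *v x = xp (g x)" and S: "S *v x = yp (g x)" for x
    unfolding P_def S_def using g(1) by (simp_all add: matrix_works linear_compose)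
  define N where "N = S + transpose S - transpose P ** S
    + (2 / m) *\<^sub>R (transpose (mat 1 - P) ** (mat 1 - P))"
  have PS: "xp (g x) \<bullet> yp (g y) = yp (g x) \<bullet> xp (g y)" for x y
    using symm g(2) by blast
  \<comment> \<open>\<open>P\<close> projects onto the image of \<open>E\<close> under \<open>xp\<close>, on which \<open>S\<close> is the given map; the last
    summand of \<open>N\<close> makes the form large on the kernel of \<open>P\<close>.\<close>
  have form: "x \<bullet> (N *v y) = x \<bullet> yp (g y) + yp (g x) \<bullet> y - xp (g x) \<bullet> yp (g y)
      + 2 / m * ((x - xp (g x)) \<bullet> (y - xp (g y)))" for x y
    by (simp add: N_def matrix_vector_mult_add_rdistrib matrix_vector_mult_diff_rdistrib
        matrix_vector_mul_assoc[symmetric] scaleR_matrix_vector_assoc[symmetric]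
        inner_add_right inner_diff_right inner_vector_matrix P S)
  show ?thesis
  proof
    have "x \<bullet> (N *v y) = y \<bullet> (N *v x)" for x y
      using PS[of x y] by (simp add: form inner_commute)
    then show "transpose N = N"
      by (intro transpose_eqI) (simp add: inner_commute)
  next
    fix v assume v: "v \<in> E"
    \<comment> \<open>Here \<open>g (xp v) = v\<close>: the last summand of the form vanishes and
      the two middle ones cancel by isotropy.\<close>
    have "x \<bullet> (N *v xp v) = x \<bullet> yp v" for x
      using symm[OF g(2)[of x] v] by (simp add: form g(3)[OF v])
    then show "yp v = N *v xp v" by (metis vector_eq_ldot)
  next
    fix x :: "real^'n" assume x: "x \<noteq> 0"
    define v where "v = g x"
    define z where "z = x - xp v"
    define a where "a = norm v"
    define b where "b = norm z"
    have xz: "x = xp v + z" by (simp add: z_def)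
    have "norm (yp v) \<le> a"
      unfolding a_def norm_eq_sqrt_inner by (simp add: inner_eq_xp_yp[of v v])
    then have "b * norm (yp v) \<le> b * a"
      by (intro mult_left_mono) (auto simp: b_def)
    then have "z \<bullet> yp v \<ge> - (b * a)"
      using Cauchy_Schwarz_ineq2[of z "yp v"] unfolding b_def by linarith
    moreover have "hyp v \<ge> m * a\<^sup>2"
      unfolding a_def using m(2)[of v] g(2) by (simp add: v_def)
    moreover have "x \<bullet> (N *v x) = hyp v + 2 * (z \<bullet> yp v) + 2 / m * b\<^sup>2"
      unfolding form v_def[symmetric] z_def[symmetric] b_def
      by (subst (1 2) xz) (simp add: hyp_def inner_add_left inner_add_right inner_commute power2_norm_eq_inner)
    ultimately have "x \<bullet> (N *v x) \<ge> m * a\<^sup>2 - 2 * (b * a) + 2 / m * b\<^sup>2"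
      by linarith
    \<comment> \<open>Completing the square explains the factor \<open>2 / m\<close>: one
      \<open>1 / m\<close> absorbs the cross term, the other leaves a strictly positive rest when
      \<open>b\<close> is nonzero.\<close>
    also have "m * a\<^sup>2 - 2 * (b * a) + 2 / m * b\<^sup>2 = m * (a - b / m)\<^sup>2 + b\<^sup>2 / m"
      using m(1) by (simp add: power2_eq_square field_simps)
    finally have ge: "m * (a - b / m)\<^sup>2 + b\<^sup>2 / m \<le> x \<bullet> (N *v x)" .
    have "0 < m * (a - b / m)\<^sup>2 + b\<^sup>2 / m"
    proof (cases "b = 0")
      case True
      then have "a \<noteq> 0" using x xz by (auto simp: a_def b_def)
      with True m(1) show ?thesis by simp
    next
      case False
      with m(1) show ?thesis by (intro add_nonneg_pos) auto
    qed
    with ge show "x \<bullet> (N *v x) > 0" by linarith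
  qed
qed

section \<open>An open criterion for membership in \<open>G_pos\<close>\<close>

text \<open>By homogeneity it suffices to test unit vectors. The set of failures is then the
  projection of a closed set along a compact sphere, hence closed.\<close>

lemma open_pos_form:
  fixes A B :: "'a::euclidean_space \<Rightarrow> real^'n^'m"
  assumes "continuous_on UNIV A" "continuous_on UNIV B"
  shows "open {h. \<forall>x. x \<noteq> 0 \<longrightarrow> 0 < (A h *v x) \<bullet> (B h *v x)}"
proof -
  define f where "f p = (A (snd p) *v fst p) \<bullet> (B (snd p) *v fst p)" for p :: "(real^'n) \<times> 'a"
  have "continuous_on UNIV f"
    unfolding f_def[abs_def] matrix_vector_mult_def
    by (intro continuous_intros continuous_on_compose2[OF assms(1)] continuous_on_compose2[OF assms(2)]) auto
  then have "closed {p. f p \<le> 0}"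
    by (intro closed_Collect_le continuous_intros)
  then have "closed {h. \<exists>x. x \<in> sphere 0 1 \<and> (x, h) \<in> {p. f p \<le> 0}}"
    by (intro closed_compact_projection compact_sphere)
  moreover have "{h. \<forall>x. x \<noteq> 0 \<longrightarrow> 0 < (A h *v x) \<bullet> (B h *v x)}
      = - {h. \<exists>x. x \<in> sphere 0 1 \<and> (x, h) \<in> {p. f p \<le> 0}}"
  proof (intro equalityI subsetI ComplI; clarsimp simp: f_def)
    fix h x assume "\<forall>x. x \<noteq> 0 \<longrightarrow> 0 < (A h *v x) \<bullet> (B h *v x)" "norm x = 1"
      "(A h *v x) \<bullet> (B h *v x) \<le> 0"
    then show False by (metis norm_zero not_less zero_neq_one)
  next
    fix h and x :: "real^'n"
    assume *: "\<forall>x. norm x = 1 \<longrightarrow> \<not> (A h *v x) \<bullet> (B h *v x) \<le> 0" and x: "x \<noteq> 0"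
    then have "0 < (A h *v ((1 / norm x) *\<^sub>R x)) \<bullet> (B h *v ((1 / norm x) *\<^sub>R x))"
      by (simp add: not_le)
    with x show "0 < (A h *v x) \<bullet> (B h *v x)"
      by (simp add: matrix_vector_mult_scaleR zero_less_mult_iff zero_less_divide_iff)
  qed
  ultimately show ?thesis by (simp only: open_Compl)
qed

text \<open>The factorization \<open>h = U\<^sup>o\<^sup>p\<^sup>p(C A\<inverse>) diag(A, A\<^sup>-\<^sup>T) U(A\<inverse> B)\<close>; both positivity conditions are
  polynomial in the blocks of \<open>h\<close>, hence open.\<close>

lemma G_nonneg_factorization:
  fixes A B C D :: "real^'n::finite^'n"
  assumes Sp: "block_matrix A B C D \<in> Sp" and det: "det A > 0"
    and C: "\<And>x. (A *v x) \<bullet> (C *v x) \<ge> 0"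
    and B: "\<And>x. (transpose A *v x) \<bullet> (transpose B *v x) \<ge> 0"
  shows "block_matrix A B C D \<in> G_nonneg"
proof -
  have invA: "A ** matrix_inv A = mat 1" "transpose A ** matrix_inv (transpose A) = mat 1"
    using det by (simp_all add: matrix_inv_right_inverse invertible_det_nz)
  then have invA': "matrix_inv A ** A = mat 1" "matrix_inv (transpose A) ** transpose A = mat 1"
    by (simp_all only: matrix_left_right_inverse)
  have cancel: "A *v (matrix_inv A *v x) = x" "matrix_inv A *v (A *v x) = x"
    "transpose A *v (matrix_inv (transpose A) *v x) = x" "matrix_inv (transpose A) *v (transpose A *v x) = x" for x
    by (simp_all only: matrix_vector_mul_assoc invA invA' matrix_vector_mul_lid)
  have symp: "symp (block_matrix A B C D *v v) (block_matrix A B C D *v w) = symp v w" for v w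
    using Sp by (simp add: Sp_def)
  define N where "N = C ** matrix_inv A"
  define M where "M = matrix_inv A ** B"
  have N: "N *v x = C *v (matrix_inv A *v x)" and M: "M *v x = matrix_inv A *v (B *v x)" for x
    by (simp_all add: N_def M_def matrix_vector_mul_assoc)
  \<comment> \<open>The test vectors lie in \<open>L_zero\<close> and are sent to
    \<open>join x (N *v x)\<close> and \<open>join y (N *v y)\<close>, whose pairing must therefore
    vanish.\<close>
  have symN: "x \<bullet> (N *v y) = (N *v x) \<bullet> y" for x y
    using symp[of "join (matrix_inv A *v x) 0" "join (matrix_inv A *v y) 0"]
    by (simp add: symp_eq N cancel)
  have AM: "A *v (M *v y) = B *v y" for y
    by (simp add: M cancel)
  \<comment> \<open>These vectors are chosen so that their images lie in \<open>L_infty\<close>;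
    hence they pair to zero.\<close>
  have symM: "x \<bullet> (M *v y) = (M *v x) \<bullet> y" for x y
    using symp[of "join (- (M *v x)) x" "join (- (M *v y)) y"]
    by (simp add: symp_eq AM linear_neg[OF matrix_vector_mul_linear])
  \<comment> \<open>Pairing the image of \<open>L_zero\<close> with these vectors identifies the
    Schur complement of \<open>A\<close> as the inverse transpose of \<open>A\<close>.\<close>
  have D: "matrix_inv (transpose A) *v y = D *v y - C *v (M *v y)" for y
  proof -
    have "x \<bullet> (transpose A *v (D *v y - C *v (M *v y))) = x \<bullet> y" for x
      using symp[of "join x 0" "join (- (M *v y)) y"]
      by (simp add: symp_eq AM linear_neg[OF matrix_vector_mul_linear] inner_vector_matrix
          inner_diff_right inner_commute)
    then have "transpose A *v (D *v y - C *v (M *v y)) = y"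
      by (metis vector_eq_ldot)
    then show ?thesis by (metis cancel(4))
  qed
  have "pos_semidef_matrix N"
    unfolding pos_semidef_matrix_def
  proof (intro conjI allI transpose_eqI symN)
    show "x \<bullet> (N *v x) \<ge> 0" for x
      using C[of "matrix_inv A *v x"] by (simp add: N cancel)
  qed
  then have "block_matrix (mat 1) 0 N (mat 1) \<in> G_nonneg"
    by (auto simp: G_nonneg_def U_opp_nonneg_def intro!: semigroup_generated.base)
  moreover have "pos_semidef_matrix M"
    unfolding pos_semidef_matrix_def
  proof (intro conjI allI transpose_eqI symM)
    fix x
    \<comment> \<open>Substituting \<open>x = transpose A *v z\<close> clears the inverse in
      \<open>M\<close> and yields the hypothesis on \<open>B\<close>.\<close>
    define z where "z = matrix_inv (transpose A) *v x"
    have x: "x = transpose A *v z" by (simp only: z_def cancel)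
    have "x \<bullet> (M *v x) = z \<bullet> (B *v x)"
      by (subst (1) x) (simp add: dot_lmul_matrix AM)
    also have "\<dots> = (transpose A *v z) \<bullet> (transpose B *v z)"
      by (subst x) (simp add: inner_vector_matrix inner_commute)
    finally show "x \<bullet> (M *v x) \<ge> 0"
      using B[of z] by linarith
  qed
  then have "block_matrix (mat 1) M 0 (mat 1) \<in> G_nonneg"
    by (auto simp: G_nonneg_def U_nonneg_def intro!: semigroup_generated.base)
  moreover have "block_matrix A 0 0 (matrix_inv (transpose A)) \<in> G_nonneg"
    using det by (auto simp: G_nonneg_def L_Theta_def intro!: semigroup_generated.base)
  moreover have "block_matrix A B C D = block_matrix (mat 1) 0 N (mat 1) **
      (block_matrix A 0 0 (matrix_inv (transpose A)) ** block_matrix (mat 1) M 0 (mat 1))"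
    unfolding matrix_eq_xp_yp
    by (simp add: matrix_vector_mul_assoc[symmetric] matrix_vector_right_distrib AM D)
       (simp add: N cancel matrix_vector_right_distrib AM[symmetric])
  ultimately show ?thesis
    unfolding G_nonneg_def by (simp add: semigroup_generated.mult)
qed

text \<open>The three strict inequalities define an open set of matrices, and every symplectic
  matrix in it factors inside \<open>G_nonneg\<close>.\<close>

lemma G_posI:
  fixes A B C D :: "real^'n::finite^'n"
  assumes Sp: "block_matrix A B C D \<in> Sp" and det: "det A > 0"
    and C: "\<And>x. x \<noteq> 0 \<Longrightarrow> (A *v x) \<bullet> (C *v x) > 0"
    and B: "\<And>x. x \<noteq> 0 \<Longrightarrow> (transpose A *v x) \<bullet> (transpose B *v x) > 0"
  shows "block_matrix A B C D \<in> G_pos"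
proof -
  define a :: "real ^ ('n + 'n) ^ ('n + 'n) \<Rightarrow> real^'n^'n" where "a h = (\<chi> i j. h $ Inl i $ Inl j)" for h
  define b :: "real ^ ('n + 'n) ^ ('n + 'n) \<Rightarrow> real^'n^'n" where "b h = (\<chi> i j. h $ Inl i $ Inr j)" for h
  define c :: "real ^ ('n + 'n) ^ ('n + 'n) \<Rightarrow> real^'n^'n" where "c h = (\<chi> i j. h $ Inr i $ Inl j)" for h
  have abc: "a (block_matrix A B C D) = A" "b (block_matrix A B C D) = B" "c (block_matrix A B C D) = C"
    for A B C D by (simp_all add: a_def b_def c_def block_matrix_def vec_eq_iff)
  have cont: "continuous_on UNIV a" "continuous_on UNIV b" "continuous_on UNIV c"
    "continuous_on UNIV (\<lambda>h. transpose (a h))" "continuous_on UNIV (\<lambda>h. transpose (b h))"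
    "continuous_on UNIV (\<lambda>h. det (a h))"
    unfolding a_def[abs_def] b_def[abs_def] c_def[abs_def] transpose_def det_def
    by (auto intro!: continuous_intros)
  define T where "T = {h. 0 < det (a h)} \<inter> {h. \<forall>x. x \<noteq> 0 \<longrightarrow> 0 < (a h *v x) \<bullet> (c h *v x)}
    \<inter> {h. \<forall>x. x \<noteq> 0 \<longrightarrow> 0 < (transpose (a h) *v x) \<bullet> (transpose (b h) *v x)}"
  have "open T"
    unfolding T_def by (intro open_Int open_pos_form cont open_Collect_less continuous_intros)
  then have "openin (top_of_set Sp) (Sp \<inter> T)"
    by (rule openin_open_Int)
  moreover have "block_matrix A B C D \<in> Sp \<inter> T"
    using assms by (simp add: T_def abc)
  moreover have "Sp \<inter> T \<subseteq> G_nonneg"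
  proof
    fix h assume h: "h \<in> Sp \<inter> T"
    obtain A B C D where "h = block_matrix A B C D" by (rule block_matrix_cases)
    moreover have "(A *v x) \<bullet> (C *v x) \<ge> 0" "(transpose A *v x) \<bullet> (transpose B *v x) \<ge> 0" for x
      using h by (cases "x = 0"; auto simp: T_def abc calculation less_imp_le)+
    ultimately show "h \<in> G_nonneg"
      using h by (auto simp: T_def abc intro!: G_nonneg_factorization)
  qed
  ultimately show ?thesis
    unfolding G_pos_def interior_of_def by blast
qed

lemma G_pos_subset_Sp: "G_pos \<subseteq> Sp"
  unfolding G_pos_def using interior_of_subset_topspace[of "top_of_set Sp"] by simp

section \<open>Flags and the two inclusions\<close>

lemma flags_subset_last:
  assumes "E \<in> flags k" "V \<in> set E"
  shows "V \<subseteq> last E"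
proof -
  have len: "length E = length k" using assms by (simp add: flags_def)
  obtain i where i: "i < length E" "V = E ! i"
    using assms(2) by (metis in_set_conv_nth)
  have "E ! i \<subseteq> E ! j" if "i \<le> j" "j < length E" for j
    using that
  proof (induction j rule: dec_induct)
    case (step j)
    then have "E ! i \<subseteq> E ! j" "E ! j \<subseteq> E ! Suc j"
      using assms(1) len by (auto simp: flags_def)
    then show ?case by blast
  qed simp
  from this[of "length E - 1"] i show ?thesis
    by (cases E rule: rev_cases) (auto simp: last_conv_nth)
qed

lemma flags_image:
  assumes "linear f" "inj f" "E \<in> flags k"
  shows "map ((`) f) E \<in> flags k"
  using assms
  by (auto simp: flags_def linear_subspace_image dim_image_eq inj_on_subset[OF _ subset_UNIV])

lemma isotropic_image_Sp:
  assumes "g \<in> Sp" "isotropic V"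
  shows "isotropic ((*v) g ` V)"
  using assms by (auto simp: isotropic_def Sp_def linear_subspace_image)

lemma positive_flags_subset:
  fixes E :: "(real ^ ('n::finite + 'n)) set list"
  assumes "k \<noteq> []" "E \<in> positive_flags k"
  shows "E \<in> isotropic_flags k" "is_pos_def_graph (last E)"
proof -
  obtain g F where E: "E = map ((`) ((*v) g)) F" and g: "g \<in> G_pos" and F: "F \<in> flags k"
    and last: "last F \<subseteq> L_zero"
    using assms(2) by (auto simp: positive_flags_def)
  have Sp: "g \<in> Sp" using g G_pos_subset_Sp by auto
  have "F \<noteq> []" using assms(1) F by (auto simp: flags_def)
  have iso: "isotropic V" if "V \<in> set F" for V
  proof -
    have "yp v = 0" if "v \<in> V" for v
      using flags_subset_last[OF F \<open>V \<in> set F\<close>] last that by (auto simp flip: L_zero_iff)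
    moreover have "subspace V"
      using F that by (auto simp: flags_def in_set_conv_nth)
    ultimately show ?thesis by (simp add: isotropic_def symp_eq)
  qed
  have "E \<in> flags k"
    unfolding E using F by (intro flags_image inj_Sp Sp) auto
  then show "E \<in> isotropic_flags k"
    using iso isotropic_image_Sp[OF Sp] by (auto simp: isotropic_flags_def E)
  have "hyp (g *v v) > 0" if "v \<in> last F" "g *v v \<noteq> 0" for v
  proof -
    have "hyp v = 0" using last that by (auto simp: hyp_def L_zero_iff)
    moreover have "v \<noteq> 0" using that by auto
    ultimately show ?thesis using hyp_less_G_pos[OF g, of v] by simp
  qed
  then show "is_pos_def_graph (last E)"
    using \<open>F \<noteq> []\<close> iso isotropic_image_Sp[OF Sp]
    by (auto simp: is_pos_def_graph_iff E last_map)
qed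

lemma positive_flags_supset:
  fixes E :: "(real ^ ('n::finite + 'n)) set list"
  assumes "k \<noteq> []" "E \<in> isotropic_flags k" "is_pos_def_graph (last E)"
  shows "E \<in> positive_flags k"
proof -
  have E: "E \<in> flags k" using assms(2) by (simp add: isotropic_flags_def)
  then have "E \<noteq> []" using assms(1) by (auto simp: flags_def)
  obtain N :: "real^'n^'n" where N: "transpose N = N" "\<And>x. x \<noteq> 0 \<Longrightarrow> x \<bullet> (N *v x) > 0"
    "\<And>v. v \<in> last E \<Longrightarrow> yp v = N *v xp v"
    using pos_def_extension[of "last E"] assms(3) by (auto simp: is_pos_def_graph_iff)
  \<comment> \<open>With the upper factor given by the identity, the blocks are
    \<open>A = 1\<close>, \<open>B = 1\<close>, \<open>C = N\<close>, so \<open>G_posI\<close> only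
    asks that the identity and \<open>N\<close> be positive definite. The inverse \<open>g'\<close>
    flattens the graph of \<open>N\<close> onto \<open>L_zero\<close>.\<close>
  define g where "g = block_matrix (mat 1) 0 N (mat 1) ** block_matrix (mat 1) (mat 1) 0 (mat 1)"
  define g' where "g' = block_matrix (mat 1) (- mat 1) 0 (mat 1) ** block_matrix (mat 1) 0 (- N) (mat 1)"
  have "g \<in> Sp"
    unfolding g_def by (intro Sp_mult unipotent_in_Sp) (simp_all add: N)
  moreover have "g = block_matrix (mat 1) (mat 1) N (N + mat 1)"
    unfolding matrix_eq_xp_yp g_def
    by (simp add: matrix_vector_mul_assoc[symmetric] matrix_vector_right_distrib matrix_vector_mult_add_rdistrib)
  ultimately have "g \<in> G_pos"
    using N(2) by (auto intro!: G_posI)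
  have g': "xp (g' *v v) = xp v - (yp v - N *v xp v)" "yp (g' *v v) = yp v - N *v xp v" for v
    by (simp_all add: g'_def matrix_vector_mul_assoc[symmetric] matrix_vector_mult_minus)
  have gg': "g *v (g' *v v) = v" for v
    by (simp add: vec_eq_xp_yp g' g_def matrix_vector_mul_assoc[symmetric])
  have "inj ((*v) g')"
    by (metis gg' injI)
  then have "map ((`) ((*v) g')) E \<in> flags k"
    using E by (intro flags_image) auto
  moreover have "last (map ((`) ((*v) g')) E) \<subseteq> L_zero"
    using \<open>E \<noteq> []\<close> N(3) by (auto simp: last_map L_zero_iff g')
  moreover have "E = map ((`) ((*v) g)) (map ((`) ((*v) g')) E)"
    by (simp add: image_image gg' o_def)
  ultimately show ?thesis
    using \<open>g \<in> G_pos\<close> unfolding positive_flags_def by blast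
qed

theorem corollary6p2:
  fixes k :: "nat list"
  assumes "k \<noteq> []"
    and "0 < hd k"
    and "sorted_wrt (<) k"
    and "last k \<le> CARD('n::finite)"
  shows "(positive_flags k :: (real ^ ('n + 'n)) set list set) =
           {E \<in> isotropic_flags k. is_pos_def_graph (last E)} \<and>
         (\<forall>E \<in> (isotropic_flags k :: (real ^ ('n + 'n)) set list set).
            is_pos_def_graph (last E) \<longrightarrow> (\<forall>V\<in>set E. is_pos_def_graph V))"
proof (intro conjI ballI impI)
  show "(positive_flags k :: (real ^ ('n + 'n)) set list set) =
      {E \<in> isotropic_flags k. is_pos_def_graph (last E)}"
    using positive_flags_subset[OF assms(1)] positive_flags_supset[OF assms(1)] by blast
next
  fix E :: "(real ^ ('n + 'n)) set list" and V
  assume "E \<in> isotropic_flags k" "is_pos_def_graph (last E)" "V \<in> set E"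
  \<comment> \<open>Isotropy of \<open>V\<close> is given, and positivity of the form restricts from
    \<open>last E\<close> to its subset \<open>V\<close>.\<close>
  then show "is_pos_def_graph V"
    using flags_subset_last[of E k V] by (auto simp: isotropic_flags_def is_pos_def_graph_iff)
qed

end
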